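(* Let $p,q\ge 0$ be real numbers with $q+3p>0$, and let $G$ be a graph on $n$ vertices which contains at most $pn$ cherries and in which each vertex is contained in at most $q$ cherries. If $$k\le \frac13\Big(\frac56\Big)^5\,\frac{n-2}{q+3p},$$ then every locally $k$-bounded edge colouring $\chi$ of the complete graph $K_n$ is $G$-proper, that is, $K_n$ contains a copy of $G$ which is properly coloured by $\chi$.
   Context: Graphs are finite and simple. A cherry in a graph $G$ is a copy of a path of length $2$ (two edges, three vertices) in $G$, as a subgraph; a vertex is contained in a cherry if it is any one of its three vertices. An edge colouring is an arbitrary assignment of colours to edges (not necessarily proper). An edge colouring $\chi$ of a graph $F$ is locally $k$-bounded if for every vertex $v$ of $F$ no colour is used by $\chi$ more than $k$ times on the edges of $F$ incident to $v$. For an $n$-vertex graph $G$, a copy of $G$ in $K_n$ is the image of $G$ under an injection $\sigma\colon V(G)\to V(K_n)$, with edges $\sigma(x)\sigma(y)$ for $xy\in E(G)$. A copy is properly coloured by $\chi$ if any two distinct edges of the copy sharing a vertex receive different colours from $\chi$. A colouring $\chi$ of the edges of $K_n$ is $G$-proper if $K_n$ contains a copy of $G$ which is properly coloured by $\chi$. *)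

theory Defs
  imports Complex_Main "HOL-Library.Ramsey"
begin

record 'a ugraph =
  verts :: "'a set"
  edges :: "'a set set"

text \<open>Finite simple graphs: an edge is a two-element set of vertices. Recall that
  \<open>nsets V 2\<close> is the set of all two-element subsets of \<open>V\<close>.\<close>

definition simple_graph :: "'a ugraph \<Rightarrow> bool" where
  "simple_graph G \<longleftrightarrow> finite (verts G) \<and> edges G \<subseteq> nsets (verts G) 2"

definition subgraph :: "'a ugraph \<Rightarrow> 'a ugraph \<Rightarrow> bool" where
  "subgraph H G \<longleftrightarrow> verts H \<subseteq> verts G \<and> edges H \<subseteq> edges G"

definition complete_graph :: "nat \<Rightarrow> nat ugraph" where
  "complete_graph n = \<lparr>verts = {..<n}, edges = nsets {..<n} 2\<rparr>"

text \<open>Cherries are counted as subgraphs, so the paths \<open>x y z\<close> and \<open>z y x\<close> give the same cherry,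
  whereas a triangle contains three cherries.\<close>

definition is_cherry :: "'a ugraph \<Rightarrow> bool" where
  "is_cherry H \<longleftrightarrow> (\<exists>x y z. distinct [x, y, z] \<and> H = \<lparr>verts = {x, y, z}, edges = {{x, y}, {y, z}}\<rparr>)"

definition cherries :: "'a ugraph \<Rightarrow> 'a ugraph set" where
  "cherries G = {H. is_cherry H \<and> subgraph H G}"

definition image_graph :: "('a \<Rightarrow> 'b) \<Rightarrow> 'a ugraph \<Rightarrow> 'b ugraph" where
  "image_graph \<sigma> G = \<lparr>verts = \<sigma> ` verts G, edges = (\<lambda>e. \<sigma> ` e) ` edges G\<rparr>"

text \<open>Used when \<open>G\<close> has exactly \<open>n\<close> vertices.\<close>

definition is_copy :: "'a ugraph \<Rightarrow> nat \<Rightarrow> nat ugraph \<Rightarrow> bool" where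
  "is_copy G n H \<longleftrightarrow>
     (\<exists>\<sigma>. inj_on \<sigma> (verts G) \<and> \<sigma> ` verts G \<subseteq> verts (complete_graph n) \<and> H = image_graph \<sigma> G)"

text \<open>An edge colouring of a graph is a function on sets of vertices; only its values on the
  edges of the graph matter.\<close>

definition locally_bounded :: "nat \<Rightarrow> 'a ugraph \<Rightarrow> ('a set \<Rightarrow> 'c) \<Rightarrow> bool" where
  "locally_bounded k F \<chi> \<longleftrightarrow>
     (\<forall>v \<in> verts F. \<forall>c. card {e \<in> edges F. v \<in> e \<and> \<chi> e = c} \<le> k)"

definition properly_coloured :: "('a set \<Rightarrow> 'c) \<Rightarrow> 'a ugraph \<Rightarrow> bool" where
  "properly_coloured \<chi> H \<longleftrightarrow>
     (\<forall>e \<in> edges H. \<forall>f \<in> edges H. e \<noteq> f \<and> e \<inter> f \<noteq> {} \<longrightarrow> \<chi> e \<noteq> \<chi> f)"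

definition G_proper :: "'a ugraph \<Rightarrow> nat \<Rightarrow> (nat set \<Rightarrow> 'c) \<Rightarrow> bool" where
  "G_proper G n \<chi> \<longleftrightarrow> (\<exists>H. is_copy G n H \<and> properly_coloured \<chi> H)"

end

theory Submission
  imports Defs "HOL-Combinatorics.Permutations"
begin

text \<open>Embed \<open>G\<close> by a uniformly random bijection and forbid every event ``a given cherry of \<open>G\<close> lands
  on a given monochromatic path of \<open>K\<^sub>n\<close>''. Events using disjoint vertices on both sides are
  negatively dependent, so the cluster expansion form of the lopsided local lemma applies. The
  neighbourhood of an event is covered by six cliques, one for each of its three vertices in \<open>G\<close> and
  its three vertices in \<open>K\<^sub>n\<close>. If all events have weight \<open>\<mu>\<close> and there are at most \<open>m\<close> monochromatic
  paths, these cliques have weight at most \<open>q m \<mu>\<close> and \<open>3 p m \<mu>\<close>, respectively, so by AM-GM the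
  criterion asks for \<open>s / (1 + s)^6\<close> to be large, where \<open>s = (q + 3 p) m \<mu> / 2\<close>; the best choice
  \<open>s = 1/5\<close> gives the constant \<open>(5/6)^5 / 3\<close>.\<close>

section \<open>The cluster expansion criterion\<close>

text \<open>Only distinct elements are tested, so \<open>N\<close> may be reflexive, as
  \<open>cluster_expansion\<close> demands.\<close>

definition indep_sets :: "('i \<Rightarrow> 'i \<Rightarrow> bool) \<Rightarrow> 'i set \<Rightarrow> 'i set set" where
  "indep_sets N S = {J. J \<subseteq> S \<and> (\<forall>i\<in>J. \<forall>j\<in>J. i \<noteq> j \<longrightarrow> \<not> N i j)}"

text \<open>The multivariate independence polynomial of the graph \<open>N\<close> on
  \<open>S\<close>, that is, the partition function of the hard-core lattice gas with activities
  \<open>\<mu>\<close>.\<close>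

definition indep_poly :: "('i \<Rightarrow> 'i \<Rightarrow> bool) \<Rightarrow> ('i \<Rightarrow> real) \<Rightarrow> 'i set \<Rightarrow> real" where
  "indep_poly N \<mu> S = (\<Sum>J\<in>indep_sets N S. \<Prod>i\<in>J. \<mu> i)"

lemma finite_indep_sets: "finite S \<Longrightarrow> finite (indep_sets N S)"
  by (rule finite_subset[of _ "Pow S"]) (auto simp: indep_sets_def)

lemma indep_poly_empty [simp]: "indep_poly N \<mu> {} = 1"
proof -
  have "indep_sets N {} = {{}}"
    by (auto simp: indep_sets_def)
  then show ?thesis
    by (simp add: indep_poly_def)
qed

lemma indep_poly_mono:
  assumes "finite T" "S \<subseteq> T" "\<And>i. \<mu> i \<ge> 0"
  shows "indep_poly N \<mu> S \<le> indep_poly N \<mu> T"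
  unfolding indep_poly_def
proof (rule sum_mono2)
  show "indep_sets N S \<subseteq> indep_sets N T"
    using assms(2) by (auto simp: indep_sets_def)
qed (use assms in \<open>auto simp: finite_indep_sets intro: prod_nonneg\<close>)

lemma indep_poly_ge_1:
  assumes "finite S" "\<And>i. \<mu> i \<ge> 0"
  shows "indep_poly N \<mu> S \<ge> 1"
  using indep_poly_mono[of S "{}" \<mu> N] assms by simp

text \<open>Independent sets either avoid \<open>a\<close> or consist of \<open>a\<close> and an
  independent set of non-neighbours of \<open>a\<close>. This deletion recursion drives every later
  estimate.\<close>

lemma indep_poly_insert:
  assumes "finite T" "a \<notin> T" "symp N"
  shows "indep_poly N \<mu> (insert a T) = indep_poly N \<mu> T + \<mu> a * indep_poly N \<mu> {j\<in>T. \<not> N a j}"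
proof -
  let ?T' = "{j\<in>T. \<not> N a j}"
  have split: "indep_sets N (insert a T) = indep_sets N T \<union> insert a ` indep_sets N ?T'"
  proof (intro equalityI subsetI)
    fix J assume J: "J \<in> indep_sets N (insert a T)"
    show "J \<in> indep_sets N T \<union> insert a ` indep_sets N ?T'"
    proof (cases "a \<in> J")
      case True
      then have "J - {a} \<in> indep_sets N ?T'"
        using J by (auto simp: indep_sets_def)
      moreover have "J = insert a (J - {a})"
        using True by auto
      ultimately show ?thesis
        by blast
    qed (use J in \<open>auto simp: indep_sets_def\<close>)
  next
    fix J assume "J \<in> indep_sets N T \<union> insert a ` indep_sets N ?T'"
    then show "J \<in> indep_sets N (insert a T)"
      using sympD[OF assms(3)] by (auto simp: indep_sets_def)
  qed
  have notin: "a \<notin> J" "finite J" if "J \<in> indep_sets N ?T'" for J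
    using that assms finite_subset[of J T] by (auto simp: indep_sets_def)
  have inj: "inj_on (insert a) (indep_sets N ?T')"
    using notin by (meson inj_onI insert_ident)
  have "indep_poly N \<mu> (insert a T) =
      indep_poly N \<mu> T + (\<Sum>J\<in>insert a ` indep_sets N ?T'. \<Prod>i\<in>J. \<mu> i)"
    unfolding indep_poly_def split
    by (rule sum.union_disjoint) (use assms in \<open>auto simp: finite_indep_sets indep_sets_def\<close>)
  also have "(\<Sum>J\<in>insert a ` indep_sets N ?T'. \<Prod>i\<in>J. \<mu> i) = \<mu> a * indep_poly N \<mu> ?T'"
    using notin by (simp add: sum.reindex[OF inj] indep_poly_def sum_distrib_left)
  finally show ?thesis .
qed

text \<open>An independent set of the union is determined by its traces on \<open>S\<close> and
  \<open>T\<close>, and weights multiply. The proof applies the deletion recursion to an element of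
  \<open>S\<close>; strong induction is needed because the recursion passes to \<open>R\<close> and
  also to the non-neighbours in \<open>R\<close>.\<close>

lemma indep_poly_Un_disjoint:
  assumes "finite S" "finite T" "S \<inter> T = {}" "symp N" "\<And>i. \<mu> i \<ge> 0"
  shows "indep_poly N \<mu> (S \<union> T) \<le> indep_poly N \<mu> S * indep_poly N \<mu> T"
  using assms(1-3)
proof (induction S arbitrary: T rule: finite_psubset_induct)
  case (psubset S)
  show ?case
  proof (cases "S = {}")
    case False
    then obtain a where a: "a \<in> S"
      by blast
    define R where "R = S - {a}"
    have S: "S = insert a R" "a \<notin> R" "R \<subset> S" "finite R"
      using a psubset.hyps by (auto simp: R_def)
    let ?r = "\<lambda>A. {j\<in>A. \<not> N a j}"
    have fin: "finite T" and aT: "a \<notin> T"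
      using psubset.prems a by auto
    have nonneg: "indep_poly N \<mu> A \<ge> 0" if "finite A" for A
      using that assms(5) by (intro order_trans[OF zero_le_one indep_poly_ge_1])
    have "indep_poly N \<mu> (?r (R \<union> T)) = indep_poly N \<mu> (?r R \<union> ?r T)"
      by (rule arg_cong) auto
    also have "\<dots> \<le> indep_poly N \<mu> (?r R) * indep_poly N \<mu> (?r T)"
      using psubset.prems S by (intro psubset.IH) auto
    also have "\<dots> \<le> indep_poly N \<mu> (?r R) * indep_poly N \<mu> T"
      using fin S assms(5) by (intro mult_left_mono indep_poly_mono nonneg) auto
    finally have "\<mu> a * indep_poly N \<mu> (?r (R \<union> T)) \<le>
        \<mu> a * (indep_poly N \<mu> (?r R) * indep_poly N \<mu> T)"
      by (rule mult_left_mono) (rule assms(5))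
    moreover have "indep_poly N \<mu> (R \<union> T) \<le> indep_poly N \<mu> R * indep_poly N \<mu> T"
      using psubset.prems S by (intro psubset.IH) auto
    moreover have "indep_poly N \<mu> (S \<union> T) =
        indep_poly N \<mu> (R \<union> T) + \<mu> a * indep_poly N \<mu> (?r (R \<union> T))"
      using indep_poly_insert[of "R \<union> T" a N \<mu>] S fin aT assms(4) by simp
    moreover have "indep_poly N \<mu> S = indep_poly N \<mu> R + \<mu> a * indep_poly N \<mu> (?r R)"
      using indep_poly_insert[of R a N \<mu>] S assms(4) by simp
    ultimately show ?thesis
      by (simp add: distrib_right mult.assoc)
  qed simp
qed

lemma indep_poly_Un:
  assumes "finite S" "finite T" "symp N" "\<And>i. \<mu> i \<ge> 0"
  shows "indep_poly N \<mu> (S \<union> T) \<le> indep_poly N \<mu> S * indep_poly N \<mu> T"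
proof -
  have "indep_poly N \<mu> (S \<union> T) \<le> indep_poly N \<mu> S * indep_poly N \<mu> (T - S)"
    using indep_poly_Un_disjoint[of S "T - S" N \<mu>] assms by auto
  also have "\<dots> \<le> indep_poly N \<mu> S * indep_poly N \<mu> T"
    using assms indep_poly_ge_1[of S \<mu> N]
    by (intro mult_left_mono indep_poly_mono) auto
  finally show ?thesis .
qed

lemma indep_poly_UN:
  assumes "finite X" "\<And>x. x \<in> X \<Longrightarrow> finite (C x)" "symp N" "\<And>i. \<mu> i \<ge> 0"
  shows "indep_poly N \<mu> (\<Union>x\<in>X. C x) \<le> (\<Prod>x\<in>X. indep_poly N \<mu> (C x))"
  using assms(1,2)
proof (induction X rule: finite_induct)
  case (insert x X)
  have "indep_poly N \<mu> (\<Union>x\<in>insert x X. C x) \<le> indep_poly N \<mu> (C x) * indep_poly N \<mu> (\<Union>x\<in>X. C x)"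
    using indep_poly_Un[of "C x" "\<Union>x\<in>X. C x" N \<mu>] insert assms by auto
  also have "\<dots> \<le> indep_poly N \<mu> (C x) * (\<Prod>x\<in>X. indep_poly N \<mu> (C x))"
    using insert assms(4) indep_poly_ge_1[of "C x" \<mu> N] by (intro mult_left_mono) auto
  finally show ?case
    using insert by simp
qed simp

lemma indep_poly_clique:
  assumes "finite C" "symp N" "\<And>i j. i \<in> C \<Longrightarrow> j \<in> C \<Longrightarrow> N i j"
  shows "indep_poly N \<mu> C = 1 + (\<Sum>i\<in>C. \<mu> i)"
  using assms(1,3)
proof (induction C rule: finite_induct)
  case (insert a C)
  have C: "{j\<in>C. \<not> N a j} = {}"
    using insert.prems by auto
  have "indep_poly N \<mu> C = 1 + sum \<mu> C"
    using insert.prems by (intro insert.IH) auto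
  then show ?case
    using insert.hyps indep_poly_insert[of C a N \<mu>] assms(2) by (simp add: C)
qed simp

text \<open>\<open>P S\<close> stands for the probability that no event of \<open>S\<close> occurs. The induction compares its
  decrements with those of \<open>S \<mapsto> indep_poly N \<mu> (I - S)\<close>.\<close>

theorem cluster_expansion:
  fixes P :: "'i set \<Rightarrow> real"
  assumes I: "finite I" and N: "symp N" "reflp N" and \<mu>: "\<And>i. \<mu> i \<ge> 0"
    and P: "\<And>S. P S \<ge> 0"
    and pr: "\<And>i. i \<in> I \<Longrightarrow> pr i \<ge> 0"
    and dep: "\<And>a S. a \<in> I \<Longrightarrow> S \<subseteq> I \<Longrightarrow> P S - P (insert a S) \<le> pr a * P {j\<in>S. \<not> N a j}"
    and bound: "\<And>a. a \<in> I \<Longrightarrow> pr a * indep_poly N \<mu> {j\<in>I. N a j} \<le> \<mu> a"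
  shows "P {} \<le> P I * indep_poly N \<mu> I"
proof -
  let ?Y = "indep_poly N \<mu>"
  have Y1: "?Y A \<ge> 1" if "A \<subseteq> I" for A
    using that I \<mu> finite_subset by (intro indep_poly_ge_1) auto
  have "\<forall>R\<subseteq>S. P R * ?Y (I - S) \<le> P S * ?Y (I - R)" if "S \<subseteq> I" for S
    using finite_subset[OF that I] that
  proof (induction S rule: finite_psubset_induct)
    case (psubset S)
    show ?case
    proof (intro allI impI)
      fix R assume R: "R \<subseteq> S"
      show "P R * ?Y (I - S) \<le> P S * ?Y (I - R)"
      proof (cases "R = S")
        case False
        then obtain a where a: "a \<in> S" "a \<notin> R"
          using R by auto
        define T where "T = S - {a}"
        have T: "S = insert a T" "a \<notin> T" "T \<subset> S" "R \<subseteq> T" "a \<in> I" "T \<subseteq> I"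
          using a R psubset.prems by (auto simp: T_def)
        have IH: "P R' * ?Y (I - T) \<le> P T * ?Y (I - R')" if "R' \<subseteq> T" for R'
          using psubset.IH[OF T(3)] T that by auto
        define T' where "T' = {j\<in>T. \<not> N a j}"
        define D where "D = {j\<in>I - S. \<not> N a j}"
        have IT: "?Y (I - T) = ?Y (I - S) + \<mu> a * ?Y D"
        proof -
          have "I - T = insert a (I - S)"
            using T by auto
          moreover have "?Y (insert a (I - S)) = ?Y (I - S) + \<mu> a * ?Y D"
            unfolding D_def using I a(1) N(1) by (intro indep_poly_insert) auto
          ultimately show ?thesis
            by simp
        qed
        \<comment> \<open>An index outside \<open>T'\<close> is a neighbour of \<open>a\<close> or a
          non-neighbour outside \<open>S\<close>; \<open>a\<close> itself is of the first kind by
          reflexivity. This is how the whole neighbourhood in \<open>bound\<close> comes in.\<close>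
        have "?Y (I - T') \<le> ?Y ({j\<in>I. N a j} \<union> D)"
          using I T reflpD[OF N(2)] by (intro indep_poly_mono \<mu>) (auto simp: T'_def D_def)
        also have "\<dots> \<le> ?Y {j\<in>I. N a j} * ?Y D"
          using I N \<mu> by (intro indep_poly_Un) (auto simp: D_def)
        finally have "pr a * ?Y (I - T') \<le> pr a * ?Y {j\<in>I. N a j} * ?Y D"
          using pr[OF T(5)] by (simp add: mult_left_mono mult.assoc)
        also have "\<dots> \<le> \<mu> a * ?Y D"
          using bound[OF T(5)] Y1[of D] by (intro mult_right_mono) (auto simp: D_def)
        finally have *: "pr a * ?Y (I - T') \<le> \<mu> a * ?Y D" .
        have "pr a * P T' * ?Y (I - T) \<le> pr a * (P T * ?Y (I - T'))"
          using IH[of T'] pr[OF T(5)] by (simp add: T'_def mult_left_mono mult.assoc)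
        also have "\<dots> = P T * (pr a * ?Y (I - T'))"
          by simp
        also have "\<dots> \<le> P T * (\<mu> a * ?Y D)"
          by (intro mult_left_mono * P)
        finally have **: "pr a * P T' * ?Y (I - T) \<le> P T * (\<mu> a * ?Y D)" .
        \<comment> \<open>Relative to \<open>P T\<close>, adding the event \<open>a\<close> costs no
          more than the relative loss \<open>\<mu> a * ?Y D / ?Y (I - T)\<close> from removing
          \<open>a\<close> on the side of \<open>?Y\<close>.\<close>
        have "(P T - P S) * ?Y (I - T) \<le> pr a * P T' * ?Y (I - T)"
          using dep[OF T(5,6)] T Y1[of "I - T"] unfolding T'_def by (intro mult_right_mono) auto
        with ** have step: "P T * ?Y (I - S) \<le> P S * ?Y (I - T)"
          unfolding IT by (simp add: algebra_simps)
        \<comment> \<open>The comparison of \<open>T\<close> with \<open>S\<close> is chained with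
          that of \<open>R\<close> with \<open>T\<close>; the factor \<open>?Y (I - T)\<close>, at
          least 1, cancels at the end.\<close>
        have "(P R * ?Y (I - S)) * ?Y (I - T) = (P R * ?Y (I - T)) * ?Y (I - S)"
          by simp
        also have "\<dots> \<le> (P T * ?Y (I - R)) * ?Y (I - S)"
          using IH[OF T(4)] Y1[of "I - S"] by (intro mult_right_mono) auto
        also have "\<dots> = (P T * ?Y (I - S)) * ?Y (I - R)"
          by simp
        also have "\<dots> \<le> (P S * ?Y (I - T)) * ?Y (I - R)"
          using step Y1[of "I - R"] by (intro mult_right_mono) auto
        also have "\<dots> = (P S * ?Y (I - R)) * ?Y (I - T)"
          by simp
        finally show ?thesis
          using Y1[of "I - T"] by (simp add: mult_le_cancel_right)
      qed simp
    qed
  qed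
  from this[of I] show ?thesis
    by auto
qed

section \<open>Random permutations\<close>

text \<open>Events are partial maps, encoded as sets of pairs. Divided by the factorial of
  \<open>card U\<close>, the cardinality is the probability that a uniform permutation realises
  \<open>F\<close> and none of the events in \<open>\<S>\<close>.\<close>

definition avoiding_perms :: "'b set \<Rightarrow> ('b \<times> 'b) set \<Rightarrow> ('b \<times> 'b) set set \<Rightarrow> ('b \<Rightarrow> 'b) set" where
  "avoiding_perms U F \<S> = {\<pi>. \<pi> permutes U \<and> (\<forall>(x, a)\<in>F. \<pi> x = a) \<and> (\<forall>M\<in>\<S>. \<exists>(x, a)\<in>M. \<pi> x \<noteq> a)}"

lemma finite_avoiding_perms: "finite U \<Longrightarrow> finite (avoiding_perms U F \<S>)"
  by (rule finite_subset[OF _ finite_permutations[of U]]) (auto simp: avoiding_perms_def)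

text \<open>Composing with the transposition of \<open>c\<close> and \<open>c'\<close> moves the image of \<open>x\<close> from \<open>c\<close> to any
  admissible \<open>c'\<close>. It cannot create a forbidden pattern, since those mention neither \<open>x\<close> nor \<open>c\<close>.\<close>

lemma card_avoiding_perms_insert:
  assumes U: "finite U" and c: "c \<in> U" "c \<notin> snd ` F"
    and \<S>: "\<And>M. M \<in> \<S> \<Longrightarrow> x \<notin> fst ` M \<and> c \<notin> snd ` M"
  shows "card (avoiding_perms U (insert (x, c) F) \<S>) * card (U - snd ` F) \<le> card (avoiding_perms U F \<S>)"
proof -
  define \<Phi> where "\<Phi> = (\<lambda>(\<pi> :: 'a \<Rightarrow> 'a, c'). transpose c c' \<circ> \<pi>)"
  let ?A = "avoiding_perms U (insert (x, c) F) \<S> \<times> (U - snd ` F)"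
  have "inj_on \<Phi> ?A"
  proof (rule inj_onI, clarify)
    fix \<pi> \<pi>' c1 c2
    assume A: "\<pi> \<in> avoiding_perms U (insert (x, c) F) \<S>" "\<pi>' \<in> avoiding_perms U (insert (x, c) F) \<S>"
      and eq: "\<Phi> (\<pi>, c1) = \<Phi> (\<pi>', c2)"
    \<comment> \<open>The new target is read off as the image of \<open>x\<close>; undoing the
      transposition then returns the permutation.\<close>
    have "\<Phi> (\<pi>, c1) x = c1" "\<Phi> (\<pi>', c2) x = c2"
      using A by (auto simp: \<Phi>_def avoiding_perms_def)
    with eq have "c1 = c2"
      by simp
    moreover from this have "transpose c c1 \<circ> (transpose c c1 \<circ> \<pi>) = transpose c c1 \<circ> (transpose c c1 \<circ> \<pi>')"
      using eq by (simp add: \<Phi>_def)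
    ultimately show "\<pi> = \<pi>' \<and> c1 = c2"
      by (simp add: fun_eq_iff)
  qed
  moreover have "\<Phi> ` ?A \<subseteq> avoiding_perms U F \<S>"
  proof clarify
    fix \<pi> c' assume \<pi>: "\<pi> \<in> avoiding_perms U (insert (x, c) F) \<S>" and c': "c' \<in> U" "c' \<notin> snd ` F"
    have perm: "\<pi> permutes U" and x: "\<pi> x = c"
      using \<pi> by (auto simp: avoiding_perms_def)
    have "transpose c c' \<circ> \<pi> permutes U"
      using perm c c' by (intro permutes_compose permutes_swap_id) auto
    moreover have "(transpose c c' \<circ> \<pi>) y = b" if "(y, b) \<in> F" for y b
    proof -
      have "b \<in> snd ` F"
        using that by (force intro: rev_image_eqI)
      then have "b \<noteq> c" "b \<noteq> c'"
        using c c' by auto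
      moreover have "\<pi> y = b"
        using that \<pi> by (auto simp: avoiding_perms_def)
      ultimately show ?thesis
        by simp
    qed
    moreover have "\<exists>(y, b)\<in>M. (transpose c c' \<circ> \<pi>) y \<noteq> b" if "M \<in> \<S>" for M
    proof (rule ccontr)
      assume "\<not> ?thesis"
      then have M: "transpose c c' (\<pi> y) = b" if "(y, b) \<in> M" for y b
        using that by auto
      \<comment> \<open>A pattern completed after the swap was already completed before it, because
        none of the values \<open>\<pi> y\<close> involved is \<open>c\<close> or
        \<open>c'\<close>.\<close>
      have "\<pi> y = b" if "(y, b) \<in> M" for y b
      proof -
        have "y \<noteq> x" "b \<noteq> c"
          using \<S>[OF \<open>M \<in> \<S>\<close>] that by force+
        then have "\<pi> y \<noteq> c"
          using x permutes_inj[OF perm] by (metis injD)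
        moreover have "\<pi> y \<noteq> c'"
          using M[OF that] \<open>b \<noteq> c\<close> by auto
        ultimately show ?thesis
          using M[OF that] by simp
      qed
      then show False
        using \<pi> \<open>M \<in> \<S>\<close> by (fastforce simp: avoiding_perms_def)
    qed
    ultimately show "\<Phi> (\<pi>, c') \<in> avoiding_perms U F \<S>"
      unfolding avoiding_perms_def \<Phi>_def by auto
  qed
  ultimately have "card ?A \<le> card (avoiding_perms U F \<S>)"
    using finite_avoiding_perms[OF U] by (rule card_inj_on_le)
  then show ?thesis
    by (simp add: card_cartesian_product)
qed

text \<open>The negative dependence estimate. The pairs of \<open>F\<close> are imposed one at a
  time, and with \<open>i\<close> pairs in place there are \<open>card U - i\<close> admissible
  targets to average over.\<close>

lemma card_avoiding_perms:
  assumes U: "finite U" and F: "finite F" "inj_on snd F" "snd ` F \<subseteq> U"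
    and \<S>: "\<And>M. M \<in> \<S> \<Longrightarrow> fst ` F \<inter> fst ` M = {} \<and> snd ` F \<inter> snd ` M = {}"
  shows "card (avoiding_perms U F \<S>) * (\<Prod>i<card F. card U - i) \<le> card (avoiding_perms U {} \<S>)"
  using F \<S>
proof (induction F rule: finite_induct)
  case (insert e F)
  obtain x c where e: "e = (x, c)"
    by fastforce
  have c: "c \<in> U" "c \<notin> snd ` F"
    using insert e by auto
  have "card (U - snd ` F) = card U - card F"
    using insert U by (subst card_Diff_subset) (auto simp: card_image)
  moreover have "card (avoiding_perms U (insert e F) \<S>) * card (U - snd ` F) \<le> card (avoiding_perms U F \<S>)"
    unfolding e using insert.prems(3) e by (intro card_avoiding_perms_insert U c) auto
  ultimately have "card (avoiding_perms U (insert e F) \<S>) * (card U - card F) * (\<Prod>i<card F. card U - i)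
      \<le> card (avoiding_perms U F \<S>) * (\<Prod>i<card F. card U - i)"
    by simp
  also have "\<dots> \<le> card (avoiding_perms U {} \<S>)"
    using insert.prems by (intro insert.IH) auto
  finally show ?case
    using insert by (simp add: mult_ac)
qed simp

section \<open>Monochromatic cherries in a locally bounded colouring\<close>

text \<open>Triples are ordered with the centre in the middle, so every path occurs in both
  directions: a cherry with a fixed orientation can land on it either way.\<close>

definition mono_paths :: "nat \<Rightarrow> (nat set \<Rightarrow> 'c) \<Rightarrow> (nat \<times> nat \<times> nat) set" where
  "mono_paths n \<chi> = {(a, b, c). a < n \<and> b < n \<and> c < n \<and> distinct [a, b, c] \<and> \<chi> {a, b} = \<chi> {b, c}}"

lemma card_colour_neighbours:
  assumes "locally_bounded k (complete_graph n) \<chi>" "v < n"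
  shows "card {w. w < n \<and> w \<noteq> v \<and> \<chi> {v, w} = c} \<le> k"
proof -
  let ?E = "{e \<in> edges (complete_graph n). v \<in> e \<and> \<chi> e = c}"
  have "inj_on (\<lambda>w. {v, w}) {w. w < n \<and> w \<noteq> v \<and> \<chi> {v, w} = c}"
    by (auto simp: inj_on_def doubleton_eq_iff)
  moreover have "(\<lambda>w. {v, w}) ` {w. w < n \<and> w \<noteq> v \<and> \<chi> {v, w} = c} \<subseteq> ?E"
    using assms(2) by (auto simp: complete_graph_def nsets_def)
  moreover have "finite ?E"
    by (simp add: complete_graph_def finite_imp_finite_nsets)
  ultimately have "card {w. w < n \<and> w \<noteq> v \<and> \<chi> {v, w} = c} \<le> card ?E"
    by (rule card_inj_on_le)
  also have "\<dots> \<le> k"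
    using assms by (auto simp: locally_bounded_def complete_graph_def)
  finally show ?thesis .
qed

lemma finite_mono_paths: "finite (mono_paths n \<chi>)"
  by (rule finite_subset[of _ "{..<n} \<times> {..<n} \<times> {..<n}"]) (auto simp: mono_paths_def)

lemma card_Sigma_le:
  assumes "finite A" "\<And>x. x \<in> A \<Longrightarrow> finite (B x)" "\<And>x. x \<in> A \<Longrightarrow> card (B x) \<le> m"
  shows "card (Sigma A B) \<le> card A * m"
  using assms sum_bounded_above[of A "\<lambda>x. card (B x)" m] by simp

text \<open>There are \<open>n - 1\<close> choices for one end and then at most \<open>k\<close> for
  the other. The first end is itself among the vertices counted by \<open>k\<close>, which gives the
  factor \<open>k\<close> rather than \<open>k - 1\<close>.\<close>

lemma card_mono_paths_centre:
  assumes "locally_bounded k (complete_graph n) \<chi>" "v < n"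
  shows "card {t \<in> mono_paths n \<chi>. fst (snd t) = v} \<le> (n - 1) * k"
proof -
  let ?S = "Sigma ({..<n} - {v}) (\<lambda>a. {c. c < n \<and> c \<noteq> v \<and> \<chi> {v, c} = \<chi> {a, v}})"
  have "card {t \<in> mono_paths n \<chi>. fst (snd t) = v} \<le> card ?S"
    by (rule card_inj_on_le[of "\<lambda>(a, b, c). (a, c)"])
      (auto simp: inj_on_def mono_paths_def)
  also have "\<dots> \<le> card ({..<n} - {v}) * k"
    by (intro card_Sigma_le card_colour_neighbours[OF assms]) auto
  finally show ?thesis
    using assms by simp
qed

lemma card_mono_paths_start:
  assumes "locally_bounded k (complete_graph n) \<chi>" "v < n"
  shows "card {t \<in> mono_paths n \<chi>. fst t = v} \<le> (n - 1) * k"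
proof -
  let ?S = "Sigma ({..<n} - {v}) (\<lambda>b. {c. c < n \<and> c \<noteq> b \<and> \<chi> {b, c} = \<chi> {v, b}})"
  have "card {t \<in> mono_paths n \<chi>. fst t = v} \<le> card ?S"
    by (rule card_inj_on_le[of snd]) (auto simp: inj_on_def mono_paths_def)
  also have "\<dots> \<le> card ({..<n} - {v}) * k"
    by (intro card_Sigma_le card_colour_neighbours[OF assms(1)]) auto
  finally show ?thesis
    using assms by simp
qed

lemma mono_paths_reverse: "(a, b, c) \<in> mono_paths n \<chi> \<Longrightarrow> (c, b, a) \<in> mono_paths n \<chi>"
  by (auto simp: mono_paths_def insert_commute)

lemma card_mono_paths_end:
  assumes "locally_bounded k (complete_graph n) \<chi>" "v < n"
  shows "card {t \<in> mono_paths n \<chi>. snd (snd t) = v} \<le> (n - 1) * k"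
proof -
  have "card {t \<in> mono_paths n \<chi>. snd (snd t) = v} \<le> card {t \<in> mono_paths n \<chi>. fst t = v}"
    by (rule card_inj_on_le[of "\<lambda>(a, b, c). (c, b, a)"])
      (auto simp: inj_on_def finite_mono_paths mono_paths_reverse)
  then show ?thesis
    using card_mono_paths_start[OF assms] by simp
qed

lemma card_mono_paths:
  assumes "locally_bounded k (complete_graph n) \<chi>"
  shows "card (mono_paths n \<chi>) \<le> n * ((n - 1) * k)"
proof -
  have "mono_paths n \<chi> = (\<Union>v<n. {t \<in> mono_paths n \<chi>. fst t = v})"
    by (auto simp: mono_paths_def)
  then have "card (mono_paths n \<chi>) = card (\<Union>v<n. {t \<in> mono_paths n \<chi>. fst t = v})"
    by (rule arg_cong)
  also have "\<dots> \<le> (\<Sum>v<n. card {t \<in> mono_paths n \<chi>. fst t = v})"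
    by (rule card_UN_le) simp
  also have "\<dots> \<le> (\<Sum>v<n. (n - 1) * k)"
    using card_mono_paths_start[OF assms] by (intro sum_mono) auto
  finally show ?thesis
    by simp
qed

definition path_verts :: "'b \<times> 'b \<times> 'b \<Rightarrow> 'b set" where
  "path_verts = (\<lambda>(a, b, c). {a, b, c})"

text \<open>The vertex may stand in any of the three positions. This 3 becomes the coefficient of
  \<open>p\<close> in \<open>q + 3 * p\<close>.\<close>

lemma card_mono_paths_through:
  assumes "locally_bounded k (complete_graph n) \<chi>" "v < n"
  shows "card {t \<in> mono_paths n \<chi>. v \<in> path_verts t} \<le> 3 * ((n - 1) * k)"
proof -
  let ?M = "mono_paths n \<chi>"
  have "{t \<in> ?M. v \<in> path_verts t} =
      {t \<in> ?M. fst t = v} \<union> {t \<in> ?M. fst (snd t) = v} \<union> {t \<in> ?M. snd (snd t) = v}"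
    by (auto simp: path_verts_def)
  also have "card \<dots> \<le>
      card ({t \<in> ?M. fst t = v} \<union> {t \<in> ?M. fst (snd t) = v}) + card {t \<in> ?M. snd (snd t) = v}"
    by (rule card_Un_le)
  also have "card ({t \<in> ?M. fst t = v} \<union> {t \<in> ?M. fst (snd t) = v}) \<le>
      card {t \<in> ?M. fst t = v} + card {t \<in> ?M. fst (snd t) = v}"
    by (rule card_Un_le)
  finally show ?thesis
    using card_mono_paths_start[OF assms] card_mono_paths_centre[OF assms] card_mono_paths_end[OF assms]
    by linarith
qed

section \<open>Properly coloured copies\<close>

text \<open>One of the two orientations is fixed for each cherry, so that a cherry and an ordered
  path specify a single event.\<close>

definition cherry_path :: "'a ugraph \<Rightarrow> 'a \<times> 'a \<times> 'a" where
  "cherry_path H = (SOME (x, y, z). distinct [x, y, z] \<and> H = \<lparr>verts = {x, y, z}, edges = {{x, y}, {y, z}}\<rparr>)"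

lemma cherry_path:
  assumes "is_cherry H"
  obtains x y z where "cherry_path H = (x, y, z)" "distinct [x, y, z]"
    "H = \<lparr>verts = {x, y, z}, edges = {{x, y}, {y, z}}\<rparr>"
proof -
  let ?Q = "\<lambda>(x, y, z). distinct [x, y, z] \<and> H = \<lparr>verts = {x, y, z}, edges = {{x, y}, {y, z}}\<rparr>"
  have "\<exists>t. ?Q t"
    using assms by (auto simp: is_cherry_def)
  then have "?Q (cherry_path H)"
    unfolding cherry_path_def by (rule someI_ex)
  then show thesis
    using that by (cases "cherry_path H") auto
qed

text \<open>The centre is the only vertex common to both edges, so only the two ends can be
  exchanged.\<close>

lemma cherry_eqD:
  assumes "distinct [x, y, z]" "distinct [x', y', z']"
    and "\<lparr>verts = {x, y, z}, edges = {{x, y}, {y, z}}\<rparr> = \<lparr>verts = {x', y', z'}, edges = {{x', y'}, {y', z'}}\<rparr>"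
  shows "(x', y', z') = (x, y, z) \<or> (x', y', z') = (z, y, x)"
  using assms by (auto simp: doubleton_eq_iff)

lemma finite_cherries:
  assumes "simple_graph G"
  shows "finite (cherries G)"
proof -
  have "finite (verts G)" "edges G \<subseteq> Pow (verts G)"
    using assms by (auto simp: simple_graph_def nsets_def)
  then have fin: "finite (Pow (verts G) \<times> Pow (edges G))"
    by (meson finite_Pow_iff finite_SigmaI finite_subset)
  have "cherries G \<subseteq> (\<lambda>(V, E). \<lparr>verts = V, edges = E\<rparr>) ` (Pow (verts G) \<times> Pow (edges G))"
    by (force simp: cherries_def subgraph_def is_cherry_def)
  then show ?thesis
    using fin finite_surj by blast
qed

text \<open>The event of a cherry landing on an ordered path, as a partial map. The bijection
  \<open>f\<close> renames the vertices of \<open>G\<close> as numbers below \<open>n\<close>, so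
  that random embeddings become random permutations.\<close>

definition path_pairs :: "('a \<Rightarrow> nat) \<Rightarrow> 'a ugraph \<times> nat \<times> nat \<times> nat \<Rightarrow> (nat \<times> nat) set" where
  "path_pairs f = (\<lambda>(H, a, b, c). case cherry_path H of (x, y, z) \<Rightarrow> {(f x, a), (f y, b), (f z, c)})"

lemma fst_path_pairs: "is_cherry H \<Longrightarrow> fst ` path_pairs f (H, t) = f ` verts H"
  by (erule cherry_path[of H]) (auto simp: path_pairs_def split: prod.splits)

lemma snd_path_pairs: "snd ` path_pairs f (H, t) = path_verts t"
  by (auto simp: path_pairs_def path_verts_def split: prod.splits)

text \<open>Two adjacent edges of equal colour in the copy pull back to a cherry of \<open>G\<close>
  lying on a monochromatic path. Its fixed orientation may be the opposite one, and then the
  reversed path gives the contradiction.\<close>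

lemma properly_coloured_image:
  assumes G: "simple_graph G" and \<sigma>: "inj_on \<sigma> (verts G)" "\<sigma> ` verts G \<subseteq> {..<n}"
    and avoid: "\<And>H a b c. H \<in> cherries G \<Longrightarrow> (a, b, c) \<in> mono_paths n \<chi> \<Longrightarrow>
      case cherry_path H of (x, y, z) \<Rightarrow> \<not> (\<sigma> x = a \<and> \<sigma> y = b \<and> \<sigma> z = c)"
  shows "properly_coloured \<chi> (image_graph \<sigma> G)"
  unfolding properly_coloured_def
proof (intro ballI impI notI, elim conjE)
  fix e f
  assume e: "e \<in> edges (image_graph \<sigma> G)" and f: "f \<in> edges (image_graph \<sigma> G)"
    and ne: "e \<noteq> f" and meet: "e \<inter> f \<noteq> {}" and mono: "\<chi> e = \<chi> f"
  obtain e0 f0 where e0: "e0 \<in> edges G" "e = \<sigma> ` e0" and f0: "f0 \<in> edges G" "f = \<sigma> ` f0"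
    using e f by (auto simp: image_graph_def)
  have two: "g \<subseteq> verts G \<and> (\<exists>w. g = {y, w} \<and> y \<noteq> w)" if "g \<in> edges G" "y \<in> g" for g y
  proof -
    have "g \<subseteq> verts G" "card g = 2"
      using G that by (auto simp: simple_graph_def nsets_def)
    then show ?thesis
      using that(2) by (metis card_2_iff insert_commute insertE singletonD)
  qed
  obtain y y' where y: "y \<in> e0" "y' \<in> f0" "\<sigma> y = \<sigma> y'"
    using meet e0 f0 by auto
  moreover have "y \<in> verts G" "y' \<in> verts G"
    using two e0(1) f0(1) y by blast+
  ultimately have "y = y'"
    using \<sigma>(1) by (meson inj_onD)
  obtain x where x: "e0 = {y, x}" "y \<noteq> x" "x \<in> verts G" "y \<in> verts G"
    using two[OF e0(1) y(1)] by auto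
  obtain z where z: "f0 = {y, z}" "y \<noteq> z" "z \<in> verts G"
    using two[OF f0(1) y(2)] \<open>y = y'\<close> by auto
  have "x \<noteq> z"
    using ne e0 f0 x z by auto
  define H where "H = \<lparr>verts = {x, y, z}, edges = {{x, y}, {y, z}}\<rparr>"
  have dist: "distinct [x, y, z]"
    using \<open>x \<noteq> z\<close> x z by auto
  then have ch: "is_cherry H"
    unfolding is_cherry_def H_def by blast
  then have H: "H \<in> cherries G"
    using x z e0(1) f0(1) by (auto simp: cherries_def subgraph_def H_def insert_commute)
  have "distinct [\<sigma> x, \<sigma> y, \<sigma> z]"
    using dist x z \<sigma>(1) by (auto dest: inj_onD)
  then have m: "(\<sigma> x, \<sigma> y, \<sigma> z) \<in> mono_paths n \<chi>"
    using \<sigma>(2) mono e0 f0 x z by (auto simp: mono_paths_def insert_commute)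
  from ch obtain x' y' z' where c: "cherry_path H = (x', y', z')" "distinct [x', y', z']"
    "H = \<lparr>verts = {x', y', z'}, edges = {{x', y'}, {y', z'}}\<rparr>"
    by (rule cherry_path)
  have "(x', y', z') = (x, y, z) \<or> (x', y', z') = (z, y, x)"
    using cherry_eqD[OF dist c(2)] c(3) unfolding H_def by simp
  then show False
    using avoid[OF H m] avoid[OF H mono_paths_reverse[OF m]] c(1) by auto
qed

section \<open>The random embedding, its lopsided dependency graph and the choice of weights\<close>

theorem theorem3:
  fixes p q :: real and n k :: nat and G :: "'a ugraph" and \<chi> :: "nat set \<Rightarrow> 'c"
  assumes "p \<ge> 0" and "q \<ge> 0" and "q + 3 * p > 0"
    and "simple_graph G" and "card (verts G) = n"
    and "real (card (cherries G)) \<le> p * real n"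
    and "\<forall>v \<in> verts G. real (card {H \<in> cherries G. v \<in> verts H}) \<le> q"
    and "real k \<le> 1 / 3 * (5 / 6) ^ 5 * ((real n - 2) / (q + 3 * p))"
    and "locally_bounded k (complete_graph n) \<chi>"
  shows "G_proper G n \<chi>"
proof -
  have finV: "finite (verts G)"
    using assms(4) by (simp add: simple_graph_def)
  then obtain f where f: "bij_betw f (verts G) {..<n}"
    using assms(5) by (metis bij_betw_iff_card card_lessThan finite_lessThan)
  define I where "I = cherries G \<times> mono_paths n \<chi>"
  define A where "A = path_pairs f"
  \<comment> \<open>Counts can replace probabilities, as the hypotheses and conclusion of
    \<open>cluster_expansion\<close> are unchanged when \<open>P\<close> is scaled by a positive
    factor.\<close>
  define Pr where "Pr = (\<lambda>S. real (card (avoiding_perms {..<n} {} (A ` S))))"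
  have finI: "finite I"
    by (simp add: I_def finite_cherries[OF assms(4)] finite_mono_paths)
  have "Pr I > 0"
  \<comment> \<open>The local lemma is applied only if some event exists: a monochromatic path
    forces \<open>n \<ge> 3\<close> and \<open>k \<ge> 1\<close>, which make the denominators below
    positive.\<close>
  proof (cases "I = {}")
    case True
    have "id \<in> avoiding_perms {..<n} {} {}"
      by (simp add: avoiding_perms_def permutes_id)
    then have "card (avoiding_perms {..<n} {} {}) > 0"
      using finite_avoiding_perms[of "{..<n}" "{}" "{}"] by (auto simp: card_gt_0_iff)
    then show ?thesis
      by (simp add: Pr_def True)
  next
    case False
    then obtain a b c where "(a, b, c) \<in> mono_paths n \<chi>"
      by (auto simp: I_def)
    then have abc: "a < n" "b < n" "c < n" "distinct [a, b, c]"
      by (auto simp: mono_paths_def)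
    then have "card {a, b, c} \<le> card {..<n}"
      by (intro card_mono) auto
    with abc have n3: "n \<ge> 3"
      by auto
    have "b \<in> {w. w < n \<and> w \<noteq> a \<and> \<chi> {a, w} = \<chi> {a, b}}"
      using abc by auto
    then have "card {w. w < n \<and> w \<noteq> a \<and> \<chi> {a, w} = \<chi> {a, b}} > 0"
      by (subst card_gt_0_iff) auto
    then have k1: "k \<ge> 1"
      using card_colour_neighbours[OF assms(9) abc(1), of "\<chi> {a, b}"] by linarith
    \<comment> \<open>\<open>m\<close> bounds the number of ordered monochromatic paths,
      \<open>pr\<close> is the chance that three given distinct vertices go to three given distinct
      targets, and \<open>\<mu>\<close> is chosen to make \<open>(q + 3 * p) * m * \<mu> / 2\<close>
      equal to \<open>1 / 5\<close>.\<close>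
    define m where "m = real n * ((real n - 1) * real k)"
    define \<mu> where "\<mu> = 2 / (5 * (q + 3 * p) * m)"
    define pr where "pr = 1 / (real n * (real n - 1) * (real n - 2))"
    have m: "m > 0"
      using n3 k1 by (simp add: m_def)
    have \<mu>: "\<mu> > 0"
      using m assms(3) by (simp add: \<mu>_def)
    have pr0: "pr \<ge> 0"
      using n3 by (simp add: pr_def)
    define N where "N = (\<lambda>(H :: 'a ugraph, t) (H' :: 'a ugraph, t'). H = H' \<and> t = t' \<or>
      verts H \<inter> verts H' \<noteq> {} \<or> path_verts t \<inter> path_verts t' \<noteq> ({} :: nat set))"
    have N: "symp N" "reflp N"
      by (auto simp: symp_def reflp_def N_def)
    let ?Y = "indep_poly N (\<lambda>i. \<mu>)"
    have dep: "Pr S - Pr (insert i S) \<le> pr * Pr {j\<in>S. \<not> N i j}"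
      if i: "i \<in> I" and S: "S \<subseteq> I" for i S
    proof -
      obtain H t where it: "i = (H, t)" "is_cherry H" "H \<in> cherries G" "t \<in> mono_paths n \<chi>"
        using i by (auto simp: I_def cherries_def)
      let ?S' = "{j\<in>S. \<not> N i j}"
      let ?B = "avoiding_perms {..<n} (A i) (A ` ?S')"
      \<comment> \<open>A permutation lost on adding \<open>i\<close> realises \<open>A i\<close>
        and avoids all of \<open>S\<close>, in particular the non-neighbours of \<open>i\<close>;
        these are vertex-disjoint from \<open>i\<close> on both sides, so
        \<open>card_avoiding_perms\<close> applies.\<close>
      have "avoiding_perms {..<n} {} (A ` S) \<subseteq> avoiding_perms {..<n} {} (A ` insert i S) \<union> ?B"
        by (auto simp: avoiding_perms_def)
      then have "card (avoiding_perms {..<n} {} (A ` S)) \<le>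
          card (avoiding_perms {..<n} {} (A ` insert i S) \<union> ?B)"
        by (intro card_mono) (auto simp: finite_avoiding_perms)
      also have "\<dots> \<le> card (avoiding_perms {..<n} {} (A ` insert i S)) + card ?B"
        by (rule card_Un_le)
      finally have 1: "Pr S - Pr (insert i S) \<le> real (card ?B)"
        by (simp add: Pr_def)
      obtain x y z where xyz: "cherry_path H = (x, y, z)" "distinct [x, y, z]"
        using it(2) by (rule cherry_path)
      obtain a' b' c' where t: "t = (a', b', c')"
        by (cases t)
      have Ai: "A i = {(f x, a'), (f y, b'), (f z, c')}"
        by (simp add: A_def it(1) t path_pairs_def xyz)
      have t': "distinct [a', b', c']" "a' < n" "b' < n" "c' < n"
        using it(4) t by (auto simp: mono_paths_def)
      have disj: "fst ` A i \<inter> fst ` M = {} \<and> snd ` A i \<inter> snd ` M = {}" if M: "M \<in> A ` ?S'" for M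
      proof -
        obtain H' s where j: "M = A (H', s)" "(H', s) \<in> S" "\<not> N i (H', s)"
          using M by auto
        then have H': "H' \<in> cherries G" "is_cherry H'"
          using S by (auto simp: I_def cherries_def)
        have "verts H \<inter> verts H' = {}" "path_verts t \<inter> path_verts s = {}"
          using j(3) by (auto simp: N_def it(1))
        moreover have "verts H \<subseteq> verts G" "verts H' \<subseteq> verts G"
          using it(3) H' by (auto simp: cherries_def subgraph_def)
        then have "f ` verts H \<inter> f ` verts H' = f ` (verts H \<inter> verts H')"
          by (intro inj_on_image_Int[OF bij_betw_imp_inj_on[OF f], symmetric])
        ultimately show ?thesis
          by (simp add: j(1) A_def it(1,2) H'(2) fst_path_pairs snd_path_pairs)
      qed
      have "card ?B * (\<Prod>i<card (A i). card {..<n} - i) \<le> card (avoiding_perms {..<n} {} (A ` ?S'))"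
        by (rule card_avoiding_perms) (use t' disj in \<open>auto simp: Ai\<close>)
      moreover have "card (A i) = 3"
        using t' by (simp add: Ai)
      ultimately have "card ?B * (n * (n - 1) * (n - 2)) \<le> card (avoiding_perms {..<n} {} (A ` ?S'))"
        by (simp add: eval_nat_numeral mult_ac)
      then have "real (card ?B * (n * (n - 1) * (n - 2))) \<le> Pr ?S'"
        unfolding Pr_def by (rule of_nat_mono)
      then have "real (card ?B) * (real n * (real n - 1) * (real n - 2)) \<le> Pr ?S'"
        using n3 by (simp add: of_nat_diff)
      moreover have "real n * (real n - 1) * (real n - 2) > 0"
        using n3 by simp
      ultimately have "real (card ?B) \<le> pr * Pr ?S'"
        by (simp add: pr_def pos_le_divide_eq)
      with 1 show ?thesis
        by simp
    qed
    have bound: "pr * ?Y {j\<in>I. N i j} \<le> \<mu>" if i: "i \<in> I" for i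
    proof -
      obtain H t where it: "i = (H, t)" "is_cherry H" "H \<in> cherries G" "t \<in> mono_paths n \<chi>"
        using i by (auto simp: I_def cherries_def)
      obtain x y z where xyz: "distinct [x, y, z]" "H = \<lparr>verts = {x, y, z}, edges = {{x, y}, {y, z}}\<rparr>"
        using it(2) by (auto simp: is_cherry_def)
      then have cardH: "card (verts H) = 3" "finite (verts H)" "verts H \<noteq> {}"
        by auto
      have HG: "verts H \<subseteq> verts G"
        using it(3) by (auto simp: cherries_def subgraph_def)
      have t: "card (path_verts t) = 3" "path_verts t \<subseteq> {..<n}" "finite (path_verts t)"
        using it(4) by (auto simp: mono_paths_def path_verts_def)
      \<comment> \<open>\<open>C v\<close> and \<open>D a\<close> are cliques of \<open>N\<close>:
        their members share the vertex \<open>v\<close> of \<open>G\<close>, or the vertex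
        \<open>a\<close> of \<open>K\<^sub>n\<close>. The polynomial of a clique is just 1 plus its
        total weight.\<close>
      define C where "C = (\<lambda>v. {H \<in> cherries G. v \<in> verts H} \<times> mono_paths n \<chi>)"
      define D where "D = (\<lambda>a. cherries G \<times> {s \<in> mono_paths n \<chi>. a \<in> path_verts s})"
      have finC: "finite (C v)" and finD: "finite (D a)" for v a
        by (simp_all add: C_def D_def finite_cherries[OF assms(4)] finite_mono_paths)
      have YC: "?Y (C v) \<le> 1 + q * m * \<mu>" if "v \<in> verts H" for v
      proof -
        have "?Y (C v) = 1 + card (C v) * \<mu>"
          by (subst indep_poly_clique[OF finC N(1)]) (auto simp: C_def N_def)
        moreover have "real (card (mono_paths n \<chi>)) \<le> m"
          using of_nat_mono[OF card_mono_paths[OF assms(9)], where 'a=real] n3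
          by (simp add: m_def of_nat_diff)
        then have "real (card (C v)) \<le> q * m"
          unfolding C_def card_cartesian_product of_nat_mult
          using assms(2,7) that HG by (intro mult_mono) auto
        ultimately show ?thesis
          using \<mu> by (simp add: mult_right_mono)
      qed
      have YD: "?Y (D a) \<le> 1 + 3 * p * m * \<mu>" if "a \<in> path_verts t" for a
      proof -
        have "?Y (D a) = 1 + card (D a) * \<mu>"
          by (subst indep_poly_clique[OF finD N(1)]) (auto simp: D_def N_def)
        moreover have "real (card {s \<in> mono_paths n \<chi>. a \<in> path_verts s}) \<le> 3 * ((real n - 1) * real k)"
          using of_nat_mono[OF card_mono_paths_through[OF assms(9)], of a, where 'a=real] n3 that t(2)
          by (auto simp: of_nat_diff)
        then have "real (card (D a)) \<le> p * real n * (3 * ((real n - 1) * real k))"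
          unfolding D_def card_cartesian_product of_nat_mult
          using assms(1,6) by (intro mult_mono) auto
        then have "real (card (D a)) \<le> 3 * p * m"
          by (simp add: m_def mult_ac)
        ultimately show ?thesis
          using \<mu> by (simp add: mult_right_mono)
      qed
      have Y1: "?Y B \<ge> 1" if "finite B" for B
        using indep_poly_ge_1[OF that] \<mu> by simp
      \<comment> \<open>The event \<open>i\<close> itself lies in the cover because its cherry has a
        vertex.\<close>
      have "{j\<in>I. N i j} \<subseteq> (\<Union>v\<in>verts H. C v) \<union> (\<Union>a\<in>path_verts t. D a)"
        using cardH(3) by (auto simp: I_def N_def it(1) C_def D_def)
      then have "?Y {j\<in>I. N i j} \<le> ?Y ((\<Union>v\<in>verts H. C v) \<union> (\<Union>a\<in>path_verts t. D a))"
        using \<mu> cardH t finC finD by (intro indep_poly_mono) auto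
      also have "\<dots> \<le> ?Y (\<Union>v\<in>verts H. C v) * ?Y (\<Union>a\<in>path_verts t. D a)"
        using \<mu> cardH t finC finD by (intro indep_poly_Un N) auto
      also have "\<dots> \<le> (\<Prod>v\<in>verts H. ?Y (C v)) * (\<Prod>a\<in>path_verts t. ?Y (D a))"
        using \<mu> cardH t finC finD
        by (intro mult_mono indep_poly_UN N prod_nonneg order_trans[OF zero_le_one Y1]) auto
      also have "\<dots> \<le> (\<Prod>v\<in>verts H. 1 + q * m * \<mu>) * (\<Prod>a\<in>path_verts t. 1 + 3 * p * m * \<mu>)"
        using \<mu> assms(1,2) m finC finD order_trans[OF zero_le_one Y1]
        by (intro mult_mono prod_mono prod_nonneg conjI YC YD) auto
      also have "\<dots> = ((1 + q * m * \<mu>) * (1 + 3 * p * m * \<mu>)) ^ 3"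
        by (simp add: cardH t power_mult_distrib)
      also have "\<dots> \<le> ((1 + (q + 3 * p) * m * \<mu> / 2)\<^sup>2) ^ 3"
      proof (rule power_mono)
        \<comment> \<open>AM-GM: the two sides of the next inequality differ by a quarter of this
          square.\<close>
        have "0 \<le> (q * m * \<mu> - 3 * p * m * \<mu>)\<^sup>2"
          by simp
        then show "(1 + q * m * \<mu>) * (1 + 3 * p * m * \<mu>) \<le> (1 + (q + 3 * p) * m * \<mu> / 2)\<^sup>2"
          by (simp add: power2_eq_square algebra_simps)
      qed (use \<mu> assms(1,2) m in auto)
      also have "(q + 3 * p) * m * \<mu> / 2 = 1 / 5"
        using assms(3) m by (simp add: \<mu>_def)
      finally have Y: "?Y {j\<in>I. N i j} \<le> (6 / 5) ^ 6"
        by (simp add: power_mult[symmetric])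
      have "pr * (6 / 5) ^ 6 \<le> \<mu>"
      proof -
        have "real k * (q + 3 * p) \<le> 1 / 3 * (5 / 6) ^ 5 * (real n - 2)"
          using assms(3,8) by (simp add: field_simps)
        \<comment> \<open>The constant in the bound on \<open>k\<close> is exactly what is needed
          here, as \<open>(6 / 5) ^ 6 * 5 * (1 / 3 * (5 / 6) ^ 5) = 2\<close>. Dividing by
          \<open>real n * (real n - 1)\<close>, a factor of both \<open>1 / pr\<close> and
          \<open>m\<close>, then yields the criterion.\<close>
        then have "(6 / 5) ^ 6 * (5 * (q + 3 * p) * real k) \<le> 2 * (real n - 2)"
          by (simp add: field_simps)
        then have "(6 / 5) ^ 6 / (real n - 2) \<le> 2 / (5 * (q + 3 * p) * real k)"
          using n3 k1 assms(3) by (simp add: divide_le_eq le_divide_eq mult.commute)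
        then have "(6 / 5) ^ 6 / (real n - 2) / (real n * (real n - 1))
            \<le> 2 / (5 * (q + 3 * p) * real k) / (real n * (real n - 1))"
          using n3 by (intro divide_right_mono) auto
        then show ?thesis
          by (simp add: pr_def \<mu>_def m_def mult_ac)
      qed
      moreover have "pr * ?Y {j\<in>I. N i j} \<le> pr * (6 / 5) ^ 6"
        using Y pr0 by (rule mult_left_mono)
      ultimately show ?thesis
        by simp
    qed
    have "Pr {} \<le> Pr I * ?Y I"
      by (rule cluster_expansion[where pr = "\<lambda>_. pr"])
        (use finI N \<mu> pr0 dep bound in \<open>auto simp: Pr_def\<close>)
    moreover have "Pr {} > 0"
    proof -
      have "avoiding_perms {..<n} {} (A ` {}) = {\<pi>. \<pi> permutes {..<n}}"
        by (simp add: avoiding_perms_def)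
      then show ?thesis
        by (simp add: Pr_def card_permutations)
    qed
    \<comment> \<open>\<open>Pr {}\<close> counts all permutations and is positive; since
      \<open>?Y I \<ge> 1\<close>, so is \<open>Pr I\<close>.\<close>
    ultimately have "Pr I * ?Y I > 0"
      by linarith
    then show ?thesis
      using indep_poly_ge_1[OF finI, of "\<lambda>i. \<mu>" N] \<mu> by (simp add: zero_less_mult_iff)
  qed
  then obtain \<pi> where "\<pi> \<in> avoiding_perms {..<n} {} (A ` I)"
    by (auto simp: Pr_def card_gt_0_iff)
  then have \<pi>: "\<pi> permutes {..<n}" "\<And>i. i \<in> I \<Longrightarrow> \<exists>(x, a)\<in>A i. \<pi> x \<noteq> a"
    by (auto simp: avoiding_perms_def)
  define \<sigma> where "\<sigma> = \<pi> \<circ> f"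
  have "bij_betw \<sigma> (verts G) {..<n}"
    unfolding \<sigma>_def using f permutes_imp_bij[OF \<pi>(1)] by (rule bij_betw_trans)
  then have \<sigma>: "inj_on \<sigma> (verts G)" "\<sigma> ` verts G \<subseteq> {..<n}"
    by (auto simp: bij_betw_def)
  have "properly_coloured \<chi> (image_graph \<sigma> G)"
  proof (rule properly_coloured_image[OF assms(4) \<sigma>])
    fix H a b c assume "H \<in> cherries G" "(a, b, c) \<in> mono_paths n \<chi>"
    then have "\<exists>(x, a)\<in>A (H, a, b, c). \<pi> x \<noteq> a"
      by (intro \<pi>(2)) (simp add: I_def)
    then show "case cherry_path H of (x, y, z) \<Rightarrow> \<not> (\<sigma> x = a \<and> \<sigma> y = b \<and> \<sigma> z = c)"
      by (auto simp: A_def path_pairs_def \<sigma>_def)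
  qed
  moreover have "is_copy G n (image_graph \<sigma> G)"
    unfolding is_copy_def complete_graph_def using \<sigma> by auto
  ultimately show ?thesis
    unfolding G_proper_def by blast
qed

end
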